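(* Let $X$ and $Y$ be two Banach spaces and let $\tau$ be a locally convex topology on $Y$ which is weaker than the norm topology and is induced by a separating family of seminorms $\{p_\gamma\}_{\gamma\in\Gamma}$ such that $\|y\|\le \sup_{\|p_\gamma\|\le 1}|p_\gamma(y)|$ for all $y\in Y$ (the supremum being over those $\gamma\in\Gamma$ with $\|p_\gamma\|\le 1$). Then $\mathrm{Ball}(Y)$ is $\tau$-compact if and only if $\mathrm{Ball}(B(X,Y))$ is $\tau o$-compact.
   Context: $B(X,Y)$ is the Banach space of bounded linear operators from $X$ to $Y$ with the operator norm, and $\mathrm{Ball}(\cdot)$ denotes the closed unit ball. For a seminorm $p$ on $Y$, $\|p\|=\sup\{|p(y)|:\|y\|\le 1\}$. The $\tau o$-topology on $B(X,Y)$ is the topology induced by the family of seminorms $\{x\otimes p_\gamma\}_{x\in X,\gamma\in\Gamma}$, where $(x\otimes p_\gamma)(T)=p_\gamma(T(x))$ for $x\in X$, $T\in B(X,Y)$; thus $T_\alpha\to T$ in the $\tau o$-topology if and only if $T_\alpha(x)\to T(x)$ in $\tau$ for each $x\in X$.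
   Formalization: The formal theorem assumes in addition that X is not the zero space; for X = {0} the claim fails, since Ball(B(X,Y)) = {0} is always compact while Ball(Y) need not be (e.g. Y = c_0 with its weak topology). *)

theory Defs
  imports "HOL-Analysis.Analysis"
begin

(* The scalar field: the real or the complex numbers, with the usual absolute value. *)
class real_or_complex = real_normed_field +
  assumes real_or_complex:
    "(\<forall>z::'a. \<exists>a. z = a *\<^sub>R 1) \<or>
     (\<exists>i::'a. i * i = - 1 \<and>
        (\<forall>z. \<exists>a b. z = a *\<^sub>R 1 + b *\<^sub>R i \<and> norm z = sqrt (a\<^sup>2 + b\<^sup>2)))"

instance real :: real_or_complex
  by standard simp

instance complex :: real_or_complex
proof
  have "\<exists>a b. z = a *\<^sub>R 1 + b *\<^sub>R \<i> \<and> norm z = sqrt (a\<^sup>2 + b\<^sup>2)" for z :: complex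
    by (rule exI[of _ "Re z"], rule exI[of _ "Im z"]) (simp add: complex_eq_iff cmod_def)
  then show "(\<forall>z::complex. \<exists>a. z = a *\<^sub>R 1) \<or>
     (\<exists>i::complex. i * i = - 1 \<and>
        (\<forall>z. \<exists>a b. z = a *\<^sub>R 1 + b *\<^sub>R i \<and> norm z = sqrt (a\<^sup>2 + b\<^sup>2)))"
    using i_squared by blast
qed

(* Together with the type class banach of the vectors, this makes 'a a Banach space over 'k;
   HOL-Analysis only has real Banach spaces. For 'k = real, s is forced to be scaleR. *)
definition normed_scaling ::
    "('k::real_or_complex \<Rightarrow> 'a::real_normed_vector \<Rightarrow> 'a) \<Rightarrow> bool"
  where "normed_scaling s \<longleftrightarrow>
    vector_space s \<and>
    (\<forall>r x. s (of_real r) x = r *\<^sub>R x) \<and>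
    (\<forall>c x. norm (s c x) = norm c * norm x)"

lemma normed_scaling_scaleR: "normed_scaling (scaleR :: real \<Rightarrow> 'a::real_normed_vector \<Rightarrow> 'a)"
  unfolding normed_scaling_def
  by (simp add: vector_space_def scaleR_add_left scaleR_add_right)

lemma normed_scaling_real:
  fixes s :: "real \<Rightarrow> 'a::real_normed_vector \<Rightarrow> 'a"
  assumes "normed_scaling s"
  shows "s = scaleR"
  using assms unfolding normed_scaling_def by (auto simp: fun_eq_iff)

lemma normed_scaling_times: "normed_scaling (times :: 'k::real_or_complex \<Rightarrow> 'k \<Rightarrow> 'k)"
  unfolding normed_scaling_def vector_space_def
  by (simp add: distrib_left distrib_right mult.assoc norm_mult scaleR_conv_of_real)

definition seminorm :: "('k::real_or_complex \<Rightarrow> 'a::real_normed_vector \<Rightarrow> 'a) \<Rightarrow> ('a \<Rightarrow> real) \<Rightarrow> bool"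
  where "seminorm s p \<longleftrightarrow>
    (\<forall>x y. p (x + y) \<le> p x + p y) \<and> (\<forall>c x. p (s c x) = norm c * p x)"

(* Extended-valued, so that an unbounded seminorm has norm infinity. *)
definition seminorm_norm :: "('a::real_normed_vector \<Rightarrow> real) \<Rightarrow> ennreal"
  where "seminorm_norm p = (SUP y\<in>cball 0 1. ennreal \<bar>p y\<bar>)"

definition separating :: "'i set \<Rightarrow> ('i \<Rightarrow> 'a::real_normed_vector \<Rightarrow> real) \<Rightarrow> bool"
  where "separating \<Gamma> p \<longleftrightarrow> (\<forall>y. (\<forall>\<gamma>\<in>\<Gamma>. p \<gamma> y = 0) \<longrightarrow> y = 0)"

definition seminorm_topology :: "'i set \<Rightarrow> ('i \<Rightarrow> 'a::real_vector \<Rightarrow> real) \<Rightarrow> 'a topology"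
  where "seminorm_topology \<Gamma> p = topology (\<lambda>U. \<forall>y\<in>U. \<exists>F e.
    finite F \<and> F \<subseteq> \<Gamma> \<and> e > 0 \<and> {z. \<forall>\<gamma>\<in>F. p \<gamma> (z - y) < e} \<subseteq> U)"

lemma openin_seminorm_topology:
  "openin (seminorm_topology \<Gamma> p) U \<longleftrightarrow> (\<forall>y\<in>U. \<exists>F e.
    finite F \<and> F \<subseteq> \<Gamma> \<and> e > 0 \<and> {z. \<forall>\<gamma>\<in>F. p \<gamma> (z - y) < e} \<subseteq> U)"
proof -
  define nb where "nb U y \<longleftrightarrow> (\<exists>F e. finite F \<and> F \<subseteq> \<Gamma> \<and> e > 0 \<and>
    {z. \<forall>\<gamma>\<in>F. p \<gamma> (z - y) < e} \<subseteq> U)" for U y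
  have Int: "nb (S \<inter> T) y" if "nb S y" "nb T y" for S T y
  proof -
    from that obtain F e G d where 1: "finite F" "F \<subseteq> \<Gamma>" "e > 0"
      "{z. \<forall>\<gamma>\<in>F. p \<gamma> (z - y) < e} \<subseteq> S"
      and 2: "finite G" "G \<subseteq> \<Gamma>" "d > 0" "{z. \<forall>\<gamma>\<in>G. p \<gamma> (z - y) < d} \<subseteq> T"
      unfolding nb_def by (elim exE conjE)
    have "{z. \<forall>\<gamma>\<in>F \<union> G. p \<gamma> (z - y) < min e d} \<subseteq>
        {z. \<forall>\<gamma>\<in>F. p \<gamma> (z - y) < e} \<inter> {z. \<forall>\<gamma>\<in>G. p \<gamma> (z - y) < d}"
      by auto
    also have "\<dots> \<subseteq> S \<inter> T"
      using 1(4) 2(4) by (rule Int_mono)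
    finally have 3: "{z. \<forall>\<gamma>\<in>F \<union> G. p \<gamma> (z - y) < min e d} \<subseteq> S \<inter> T" .
    have "finite (F \<union> G)" "F \<union> G \<subseteq> \<Gamma>" "min e d > 0"
      using 1(1-3) 2(1-3) by simp_all
    with 3 show ?thesis
      unfolding nb_def by (intro exI[of _ "F \<union> G"] exI[of _ "min e d"] conjI)
  qed
  have mono: "nb V y" if nb: "nb K y" and sub: "K \<subseteq> V" for K V y
  proof -
    from nb obtain F e where 1: "finite F" "F \<subseteq> \<Gamma>" "e > 0"
      and 2: "{z. \<forall>\<gamma>\<in>F. p \<gamma> (z - y) < e} \<subseteq> K"
      unfolding nb_def by (elim exE conjE)
    from 1 subset_trans[OF 2 sub] show ?thesis
      unfolding nb_def by (intro exI[of _ F] exI[of _ e] conjI)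
  qed
  have "istopology (\<lambda>U. \<forall>y\<in>U. nb U y)"
    unfolding istopology_def
  proof (intro conjI allI impI ballI)
    fix S T y
    assume "\<forall>y\<in>S. nb S y" "\<forall>y\<in>T. nb T y" "y \<in> S \<inter> T"
    then show "nb (S \<inter> T) y" by (simp add: Int)
  next
    fix \<K> y
    assume K: "\<forall>K\<in>\<K>. \<forall>y\<in>K. nb K y" and "y \<in> \<Union>\<K>"
    then obtain K where "K \<in> \<K>" "y \<in> K" by (elim UnionE)
    with K show "nb (\<Union>\<K>) y" by (metis mono Union_upper)
  qed
  then have "openin (topology (\<lambda>U. \<forall>y\<in>U. nb U y)) U \<longleftrightarrow> (\<forall>y\<in>U. nb U y)"
    by (simp only: topology_inverse')
  then show ?thesis
    unfolding nb_def seminorm_topology_def .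
qed

lemma topspace_seminorm_topology [simp]: "topspace (seminorm_topology \<Gamma> p) = UNIV"
proof -
  have "openin (seminorm_topology \<Gamma> p) UNIV"
    unfolding openin_seminorm_topology
    by (intro ballI exI[of _ "{}"] exI[of _ "1::real"]) auto
  then show ?thesis
    using openin_subset by blast
qed

(* B(X,Y): the library's blinfun type consists of the bounded real-linear operators;
   over the complex numbers, B(X,Y) is a proper subset. The norm of blinfun is the operator norm. *)
definition bounded_ops ::
    "('k::real_or_complex \<Rightarrow> 'a::real_normed_vector \<Rightarrow> 'a) \<Rightarrow>
     ('k \<Rightarrow> 'b::real_normed_vector \<Rightarrow> 'b) \<Rightarrow> ('a \<Rightarrow>\<^sub>L 'b) set"
  where "bounded_ops sX sY = {T. Vector_Spaces.linear sX sY (blinfun_apply T)}"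

lemma bounded_ops_real:
  "bounded_ops scaleR scaleR = (UNIV :: ('a::real_normed_vector \<Rightarrow>\<^sub>L 'b::real_normed_vector) set)"
  unfolding bounded_ops_def
  using bounded_linear.linear[OF blinfun.bounded_linear_right, unfolded Real_Vector_Spaces.linear_def]
  by blast

definition tau_o ::
    "('k::real_or_complex \<Rightarrow> 'a::real_normed_vector \<Rightarrow> 'a) \<Rightarrow>
     ('k \<Rightarrow> 'b::real_normed_vector \<Rightarrow> 'b) \<Rightarrow>
     'i set \<Rightarrow> ('i \<Rightarrow> 'b \<Rightarrow> real) \<Rightarrow> ('a \<Rightarrow>\<^sub>L 'b) topology"
  where "tau_o sX sY \<Gamma> p =
    subtopology (seminorm_topology ((UNIV :: 'a set) \<times> \<Gamma>) (\<lambda>(x, \<gamma>) T. p \<gamma> (blinfun_apply T x)))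
      (bounded_ops sX sY)"

end

theory Submission
  imports Defs
begin

text \<open>
  If the unit ball of \<open>Y\<close> is compact, so are all its multiples, and an operator of norm at most one
  is the same thing as a linear map that lies in the product, over all \<open>x\<close>, of the balls of
  radius \<open>norm x\<close> in \<open>Y\<close>. That product is compact by Tychonoff's theorem. Linearity is a closed
  condition on it, because the topology of \<open>Y\<close> is Hausdorff (the seminorms separate points) and
  makes addition and scaling continuous. Since the topology on operators is that of pointwise
  convergence, the unit ball of operators is a continuous image of a compact set. This is the
  argument of the Banach-Alaoglu theorem; see
  \<open>compactin_unit_ball_imp_compactin_unit_ball_ops\<close>.

  Conversely, evaluation at a unit vector \<open>a\<close> of \<open>X\<close> is continuous and sends operators of norm at
  most one to vectors of norm at most one. It is onto: by the Hahn-Banach theorem there is a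
  functional \<open>g\<close> of norm one with \<open>g a = 1\<close>, and the operator \<open>x \<mapsto> g x y\<close> has the value \<open>y\<close> at \<open>a\<close>.
  So the unit ball of \<open>Y\<close> is a continuous image of the unit ball of operators; see
  \<open>compactin_unit_ball_ops_imp_compactin_unit_ball\<close>.

  The Hahn-Banach theorem is obtained from \<open>linear_below_sublinear\<close>: a minimal sublinear functional
  is linear, and minimal ones exist below any sublinear functional by Zorn's lemma. The norming
  functional comes out by starting from the norm tilted along \<open>a\<close> (\<open>sublinear_tilt\<close>), and the
  scalar field is then extended from the reals to the complex numbers (\<open>norming_functional\<close>).
\<close>

section \<open>Minimal sublinear functionals and the Hahn-Banach theorem\<close>

text \<open>
  The inequality \<open>q (r x) \<le> r q x\<close> is enough: applied with \<open>1 / r\<close> it gives the reverse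
  one. Asking only for it halves the work when sublinearity has to be checked.
\<close>

definition sublinear :: "('a::real_vector \<Rightarrow> real) \<Rightarrow> bool"
  where "sublinear q \<longleftrightarrow>
    (\<forall>x y. q (x + y) \<le> q x + q y) \<and> (\<forall>r x. r > 0 \<longrightarrow> q (r *\<^sub>R x) \<le> r * q x)"

lemma sublinear_add: "sublinear q \<Longrightarrow> q (x + y) \<le> q x + q y"
  unfolding sublinear_def by blast

lemma sublinear_scaleR_pos:
  assumes q: "sublinear q" and r: "r > 0"
  shows "q (r *\<^sub>R x) = r * q x"
proof (rule antisym)
  show "q (r *\<^sub>R x) \<le> r * q x"
    using q r unfolding sublinear_def by blast
  have "q (inverse r *\<^sub>R (r *\<^sub>R x)) \<le> inverse r * q (r *\<^sub>R x)"
    using q r unfolding sublinear_def by (metis positive_imp_inverse_positive)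
  then show "r * q x \<le> q (r *\<^sub>R x)"
    using r by (simp add: field_simps)
qed

lemma sublinear_zero: "sublinear q \<Longrightarrow> q 0 = 0"
  using sublinear_scaleR_pos[of q 2 0] by simp

lemma sublinear_scaleR_nonneg: "sublinear q \<Longrightarrow> r \<ge> 0 \<Longrightarrow> q (r *\<^sub>R x) = r * q x"
  by (cases "r = 0") (simp_all add: sublinear_zero sublinear_scaleR_pos)

lemma sublinear_minus_le: "sublinear q \<Longrightarrow> - q (- x) \<le> q x"
  using sublinear_add[of q x "- x"] sublinear_zero[of q] by simp

lemma sublinear_norm: "sublinear norm"
  unfolding sublinear_def by (simp add: norm_triangle_ineq)

text \<open>
  An infimum of functions can be sublinear although the single functions are not: it suffices
  that any sum \<open>h i x + h j y\<close> and any positive multiple \<open>r h i x\<close> is bounded from below by a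
  member of the family, evaluated at \<open>x + y\<close> or \<open>r x\<close>. This covers both infima needed below, the
  one over the half-line that tilts a functional and the one over a chain of functionals.
\<close>

lemma sublinear_INF:
  fixes h :: "'i \<Rightarrow> 'a::real_vector \<Rightarrow> real"
  assumes ne: "I \<noteq> {}"
    and bdd: "\<And>x. bdd_below ((\<lambda>i. h i x) ` I)"
    and add: "\<And>i j. i \<in> I \<Longrightarrow> j \<in> I \<Longrightarrow> \<exists>k\<in>I. \<forall>x y. h k (x + y) \<le> h i x + h j y"
    and scale: "\<And>i r. i \<in> I \<Longrightarrow> r > 0 \<Longrightarrow> \<exists>k\<in>I. \<forall>x. h k (r *\<^sub>R x) \<le> r * h i x"
  shows "sublinear (\<lambda>x. INF i\<in>I. h i x)"
  unfolding sublinear_def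
proof (intro conjI allI impI)
  fix x y
  have *: "(INF i\<in>I. h i (x + y)) \<le> h i x + h j y" if "i \<in> I" "j \<in> I" for i j
    using add[OF that] bdd by (meson cINF_lower2)
  have "(INF i\<in>I. h i (x + y)) - h i x \<le> (INF j\<in>I. h j y)" if "i \<in> I" for i
    by (rule cINF_greatest[OF ne]) (use *[OF that] in \<open>simp add: diff_le_eq add.commute\<close>)
  then have "(INF i\<in>I. h i (x + y)) - (INF j\<in>I. h j y) \<le> (INF i\<in>I. h i x)"
    by (intro cINF_greatest[OF ne]) (simp add: algebra_simps)
  then show "(INF i\<in>I. h i (x + y)) \<le> (INF i\<in>I. h i x) + (INF i\<in>I. h i y)"
    by simp
next
  fix r :: real and x
  assume r: "r > 0"
  have "(INF i\<in>I. h i (r *\<^sub>R x)) \<le> r * h i x" if "i \<in> I" for i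
    using scale[OF that r] bdd by (meson cINF_lower2)
  then have "(INF i\<in>I. h i (r *\<^sub>R x)) / r \<le> (INF i\<in>I. h i x)"
    using r by (intro cINF_greatest[OF ne]) (simp add: field_simps)
  then show "(INF i\<in>I. h i (r *\<^sub>R x)) \<le> r * (INF i\<in>I. h i x)"
    using r by (simp add: field_simps)
qed

text \<open>
  The functional \<open>q'\<close> is the infimum of \<open>q (x + t a) - t q a\<close> over \<open>t \<ge> 0\<close>; the terms for
  \<open>t = 0\<close> and \<open>t = 1\<close> give the two bounds. It replaces the one-dimensional extension step in the
  usual proof of the Hahn-Banach theorem: at \<open>- a\<close> it is at most \<open>- q a\<close>, so that every linear
  functional below \<open>q'\<close> has the value \<open>q a\<close> at \<open>a\<close>.
\<close>

lemma sublinear_tilt: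
  assumes q: "sublinear q"
  obtains q' where "sublinear q'" "q' \<le> q" "\<And>x. q' x \<le> q (x + a) - q a"
proof
  define h where "h t x = q (x + t *\<^sub>R a) - t * q a" for t :: real and x
  have bdd: "bdd_below ((\<lambda>t. h t x) ` {0..})" for x
  proof (rule bdd_belowI2)
    fix t :: real assume "t \<in> {0..}"
    then have "t * q a = q (t *\<^sub>R a)"
      by (simp add: sublinear_scaleR_nonneg[OF q])
    also have "\<dots> \<le> q (x + t *\<^sub>R a) + q (- x)"
      using sublinear_add[OF q, of "x + t *\<^sub>R a" "- x"] by simp
    finally show "- q (- x) \<le> h t x"
      unfolding h_def by simp
  qed
  show "sublinear (\<lambda>x. INF t\<in>{0..}. h t x)"
  proof (rule sublinear_INF[OF _ bdd])
    fix s t :: real assume "s \<in> {0..}" "t \<in> {0..}"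
    moreover have "h (s + t) (x + y) \<le> h s x + h t y" for x y
      using sublinear_add[OF q, of "x + s *\<^sub>R a" "y + t *\<^sub>R a"]
      unfolding h_def by (simp add: algebra_simps)
    ultimately show "\<exists>k\<in>{0..}. \<forall>x y. h k (x + y) \<le> h s x + h t y"
      by (intro bexI[of _ "s + t"]) auto
  next
    fix t r :: real assume tr: "t \<in> {0..}" "r > 0"
    have "h (r * t) (r *\<^sub>R x) \<le> r * h t x" for x
      using sublinear_scaleR_pos[OF q tr(2), of "x + t *\<^sub>R a"]
      unfolding h_def by (simp add: algebra_simps)
    then show "\<exists>k\<in>{0..}. \<forall>x. h k (r *\<^sub>R x) \<le> r * h t x"
      using tr by (intro bexI[of _ "r * t"]) auto
  qed simp
  have "(INF t\<in>{0..}. h t x) \<le> h 0 x" for x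
    by (rule cINF_lower[OF bdd]) simp
  then show "(\<lambda>x. INF t\<in>{0..}. h t x) \<le> q"
    by (simp add: h_def le_fun_def)
  have "(INF t\<in>{0..}. h t x) \<le> h 1 x" for x
    by (rule cINF_lower[OF bdd]) simp
  then show "(INF t\<in>{0..}. h t x) \<le> q (x + a) - q a" for x
    by (simp add: h_def)
qed

text \<open>
  Zorn's lemma for the reversed pointwise order. The pointwise infimum of a chain is finite
  because every sublinear \<open>n \<le> q\<close> satisfies \<open>- q (- x) \<le> - n (- x) \<le> n x\<close>, and it is sublinear
  because the smaller of two members \<open>n\<close>, \<open>k\<close> of a chain is at most \<open>n x + k y\<close> at \<open>x + y\<close>.
\<close>

lemma minimal_sublinear_exists:
  assumes q: "sublinear q"
  obtains m where "sublinear m" "m \<le> q" "\<And>n. sublinear n \<Longrightarrow> n \<le> m \<Longrightarrow> n = m"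
proof -
  define A where "A = {n. sublinear n \<and> n \<le> q}"
  have po: "partial_order_on A (relation_of (\<ge>) A)"
    by (rule partial_order_on_relation_ofI) auto
  have "\<exists>u\<in>A. \<forall>n\<in>C. n \<ge> u" if C: "C \<in> Chains (relation_of (\<ge>) A)" for C
  proof (cases "C = {}")
    case True
    then show ?thesis using q unfolding A_def by auto
  next
    case False
    have CA: "n \<in> A" and total: "n \<le> k \<or> k \<le> n" if "n \<in> C" "k \<in> C" for n k
      using C that unfolding Chains_def relation_of_def by blast+
    have bdd: "bdd_below ((\<lambda>n. n x) ` C)" for x
    proof (rule bdd_belowI2)
      fix n assume "n \<in> C"
      then have "sublinear n" "n (- x) \<le> q (- x)"
        using CA unfolding A_def le_fun_def by blast+
      then show "- q (- x) \<le> n x"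
        using sublinear_minus_le[of n x] by linarith
    qed
    have "sublinear (\<lambda>x. INF n\<in>C. n x)"
    proof (rule sublinear_INF[OF False bdd])
      fix n k assume nk: "n \<in> C" "k \<in> C"
      have "\<exists>l\<in>C. l \<le> n \<and> l \<le> k"
        using total[OF nk] nk by blast
      then obtain l where l: "l \<in> C" "l \<le> n" "l \<le> k" by blast
      have "l (x + y) \<le> n x + k y" for x y
        using sublinear_add[of l x y] CA[OF l(1) l(1)] l(2,3)
        unfolding A_def le_fun_def by (smt (verit) mem_Collect_eq)
      with l show "\<exists>l\<in>C. \<forall>x y. l (x + y) \<le> n x + k y" by blast
    next
      fix n and r :: real assume n: "n \<in> C" and r: "r > 0"
      have "sublinear n" using CA[OF n n] unfolding A_def by blast
      then have "n (r *\<^sub>R x) \<le> r * n x" for x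
        using sublinear_scaleR_pos[of n r x] r by simp
      with n show "\<exists>k\<in>C. \<forall>x. k (r *\<^sub>R x) \<le> r * n x" by blast
    qed
    moreover have le: "(\<lambda>x. INF n\<in>C. n x) \<le> n" if "n \<in> C" for n
      unfolding le_fun_def using cINF_lower[OF bdd that] by blast
    moreover have "(\<lambda>x. INF n\<in>C. n x) \<le> q"
    proof -
      obtain n where n: "n \<in> C" using False by blast
      have "n \<le> q" using CA[OF n n] unfolding A_def by blast
      with le[OF n] show ?thesis by (rule order_trans)
    qed
    ultimately show ?thesis
      unfolding A_def by blast
  qed
  from predicate_Zorn[OF po this] obtain m where "m \<in> A" "\<And>n. n \<in> A \<Longrightarrow> n \<le> m \<Longrightarrow> n = m"
    by auto
  with that show thesis
    unfolding A_def by (metis (no_types, lifting) mem_Collect_eq order_trans)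
qed

text \<open>
  The Hahn-Banach theorem in a form that mentions no subspace: a minimal sublinear functional \<open>m\<close>
  is linear. Its tilt in any direction \<open>a\<close> equals \<open>m\<close> by minimality, so
  \<open>m x \<le> m (x + a) - m a\<close>, which together with subadditivity is additivity.
\<close>

theorem linear_below_sublinear:
  assumes q: "sublinear q"
  obtains f where "linear f" "f \<le> q"
proof -
  obtain m where m: "sublinear m" "m \<le> q" and min: "\<And>n. sublinear n \<Longrightarrow> n \<le> m \<Longrightarrow> n = m"
    by (rule minimal_sublinear_exists[OF q]) blast
  have add: "m (x + a) = m x + m a" for x a
  proof -
    obtain m' where "sublinear m'" "m' \<le> m" "\<And>x. m' x \<le> m (x + a) - m a"
      by (rule sublinear_tilt[OF m(1)]) blast
    with min have "m x \<le> m (x + a) - m a" by metis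
    with sublinear_add[OF m(1), of x a] show ?thesis by simp
  qed
  have neg: "m (- x) = - m x" for x
    using add[of x "- x"] sublinear_zero[OF m(1)] by simp
  have "m (r *\<^sub>R x) = r * m x" for r x
  proof (cases "r \<ge> 0")
    case True
    then show ?thesis by (rule sublinear_scaleR_nonneg[OF m(1)])
  next
    case False
    then show ?thesis
      using sublinear_scaleR_nonneg[OF m(1), of "- r" x] neg[of "r *\<^sub>R x"] by simp
  qed
  with add have "linear m"
    by (intro linearI) simp_all
  with m(2) that show thesis by blast
qed

section \<open>Norming functionals over the real and the complex numbers\<close>

text \<open>
  The norm is tilted along \<open>a\<close> before a linear functional is chosen below it. Then
  \<open>f (- a) \<le> - norm a\<close>, so \<open>f\<close> is forced to attain the norm at \<open>a\<close>.
\<close>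

lemma norming_real_functional:
  fixes a :: "'a::real_normed_vector"
  obtains f :: "'a \<Rightarrow> real" where "linear f" "\<And>x. \<bar>f x\<bar> \<le> norm x" "f a = norm a"
proof -
  obtain q where q: "sublinear q" "q \<le> norm" "\<And>x. q x \<le> norm (x + a) - norm a"
    by (rule sublinear_tilt[OF sublinear_norm]) blast
  obtain f where f: "linear f" "f \<le> q"
    by (rule linear_below_sublinear[OF q(1)]) blast
  have neg: "f (- x) = - f x" for x
    by (rule Real_Vector_Spaces.linear_neg[OF f(1)])
  have le: "f x \<le> norm x" for x
    using f(2) q(2) by (meson le_funD order_trans)
  have abs: "\<bar>f x\<bar> \<le> norm x" for x
    using le[of x] le[of "- x"] neg[of x] by simp
  have "f (- a) \<le> - norm a"
    using le_funD[OF f(2), of "- a"] q(3)[of "- a"] by simp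
  with neg[of a] le[of a] have "f a = norm a" by simp
  with f(1) abs that show thesis by blast
qed

lemma normed_scaling_simps:
  assumes "normed_scaling s"
  shows "s c (x + y) = s c x + s c y" "s (c + d) x = s c x + s d x"
    "s c (s d x) = s (c * d) x" "s 1 x = x" "s (of_real r) x = r *\<^sub>R x"
    "norm (s c x) = norm c * norm x"
proof -
  have vs: "vector_space s" and "s (of_real r) x = r *\<^sub>R x" and "norm (s c x) = norm c * norm x"
    using assms unfolding normed_scaling_def by blast+
  then show "s (of_real r) x = r *\<^sub>R x" "norm (s c x) = norm c * norm x"
    by blast+
  show "s c (x + y) = s c x + s c y" "s (c + d) x = s c x + s d x"
    "s c (s d x) = s (c * d) x" "s 1 x = x"
    using vs by (simp_all add: vector_space_def)
qed

text \<open>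
  Over the complex numbers the real functional \<open>f\<close> is replaced by \<open>g x = f x - i f (i x)\<close>, which is
  complex-linear with real part \<open>f\<close>. Its norm does not exceed one: multiplying \<open>x\<close> by a unimodular
  scalar makes \<open>g x\<close> real, and where \<open>g\<close> is real it agrees with \<open>f\<close>. At \<open>a\<close> the imaginary part has
  to vanish since the real part already has absolute value one.
\<close>

theorem norming_functional:
  fixes s :: "'k::real_or_complex \<Rightarrow> 'a::real_normed_vector \<Rightarrow> 'a"
  assumes s: "normed_scaling s" and a: "norm a = 1"
  obtains g :: "'a \<Rightarrow> 'k" where "\<And>x y. g (x + y) = g x + g y" "\<And>c x. g (s c x) = c * g x"
    "\<And>x. norm (g x) \<le> norm x" "g a = 1"
proof -
  obtain f :: "'a \<Rightarrow> real" where f: "linear f" and f_le: "\<And>x. \<bar>f x\<bar> \<le> norm x" and fa: "f a = 1"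
    by (rule norming_real_functional[of a]) (use a in auto)
  note f_add = Real_Vector_Spaces.linear_add[OF f]
  have f_scale: "f (r *\<^sub>R x) = r * f x" for r x
    using Real_Vector_Spaces.linear_scale[OF f] by simp
  note ss = normed_scaling_simps[OF s]
  consider (real) "\<forall>z::'k. \<exists>r. z = r *\<^sub>R 1"
    | (complex) i :: 'k where "i * i = - 1"
        "\<And>z. \<exists>u v. z = u *\<^sub>R 1 + v *\<^sub>R i \<and> norm z = sqrt (u\<^sup>2 + v\<^sup>2)"
    using real_or_complex[where 'a='k] by blast
  then show thesis
  proof cases
    case real
    have "of_real (f (s c x)) = c * (of_real (f x) :: 'k)" for c x
    proof -
      obtain r where "c = of_real r"
        using real unfolding of_real_def by blast
      then show ?thesis by (simp add: ss f_scale)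
    qed
    then show thesis
      by (intro that[of "\<lambda>x. of_real (f x)"]) (simp_all add: f_add f_le fa)
  next
    case complex
    have rep: "\<exists>u v. z = of_real u + of_real v * i" for z
      using complex(2)[of z] by (auto simp: of_real_def)
    \<comment> \<open>the coordinates of a scalar with respect to \<open>1\<close> and \<open>i\<close> are unique, since any
      \<open>u + v i\<close> divides \<open>u\<^sup>2 + v\<^sup>2\<close>\<close>
    have coords_zero: "u = 0 \<and> v = 0" if "of_real u + of_real v * i = 0" for u v
    proof (rule ccontr)
      assume uv: "\<not> (u = 0 \<and> v = 0)"
      have "(of_real u + of_real v * i) * (of_real u - of_real v * i) =
          of_real u * of_real u - i * i * (of_real v * of_real v)"
        by (simp add: algebra_simps)
      also have "\<dots> = of_real (u\<^sup>2 + v\<^sup>2)"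
        by (simp add: complex(1) power2_eq_square)
      finally have "(of_real u + of_real v * i) * (of_real u - of_real v * i) = of_real (u\<^sup>2 + v\<^sup>2)" .
      with that have "u\<^sup>2 + v\<^sup>2 = 0" by (metis mult_zero_left of_real_eq_0_iff)
      with uv show False by (simp add: sum_power2_eq_zero_iff)
    qed
    have norm_eq: "norm (of_real u + of_real v * i) = sqrt (u\<^sup>2 + v\<^sup>2)" for u v
    proof -
      obtain u' v' where uv': "of_real u + of_real v * i = of_real u' + of_real v' * i"
        and n: "norm (of_real u + of_real v * i) = sqrt (u'\<^sup>2 + v'\<^sup>2)"
        using complex(2)[of "of_real u + of_real v * i"] by (auto simp: of_real_def)
      have "of_real (u - u') + of_real (v - v') * i = 0"
        using uv' by (simp add: algebra_simps)
      with coords_zero n show ?thesis by fastforce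
    qed
    define g :: "'a \<Rightarrow> 'k" where "g x = of_real (f x) - of_real (f (s i x)) * i" for x
    have g_norm: "norm (g x) = sqrt ((f x)\<^sup>2 + (f (s i x))\<^sup>2)" for x
      using norm_eq[of "f x" "- f (s i x)"] unfolding g_def by simp
    have g_add: "g (x + y) = g x + g y" for x y
      unfolding g_def by (simp add: ss f_add algebra_simps)
    have g_scale: "g (s c x) = c * g x" for c x
    proof -
      obtain u v where c: "c = of_real u + of_real v * i" using rep by blast
      have "s i (s i x) = - x"
        using ss(5)[of "- 1" x] by (simp add: ss complex(1))
      moreover have "s c x = u *\<^sub>R x + v *\<^sub>R s i x" for x
        unfolding c by (simp add: ss(2) ss(5) ss(3)[symmetric])
      moreover have "s i (r *\<^sub>R x) = r *\<^sub>R s i x" for r x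
        using ss(3)[of i "of_real r" x] ss(3)[of "of_real r" i x] by (simp add: ss(5) mult.commute)
      ultimately have "g (s c x) = of_real (u * f x + v * f (s i x)) - of_real (u * f (s i x) - v * f x) * i"
        unfolding g_def by (simp add: ss(1) f_add f_scale Real_Vector_Spaces.linear_neg[OF f]
            Real_Vector_Spaces.linear_diff[OF f])
      also have "\<dots> = c * g x + (i * i + 1) * of_real (v * f (s i x))"
        unfolding g_def c by (simp add: algebra_simps)
      finally show ?thesis by (simp add: complex(1))
    qed
    have g_le: "norm (g x) \<le> norm x" for x
    proof (cases "g x = 0")
      case False
      \<comment> \<open>the unimodular factor that turns \<open>g x\<close> into its absolute value\<close>
      define c where "c = of_real (norm (g x)) / g x"
      have nc: "norm c = 1" unfolding c_def using False by (simp add: norm_divide)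
      have gc: "g (s c x) = of_real (norm (g x))" using False by (simp add: g_scale c_def)
      then have "of_real (f (s c x) - norm (g x)) + of_real (- f (s i (s c x))) * i = 0"
        unfolding g_def by (simp add: algebra_simps)
      from coords_zero[OF this] have "norm (g x) = f (s c x)" by simp
      also have "\<dots> \<le> norm (s c x)" using f_le[of "s c x"] by simp
      finally show ?thesis by (simp add: ss nc)
    qed simp
    have "1 + (f (s i a))\<^sup>2 \<le> 1"
      using g_le[of a] a unfolding g_norm fa by simp
    then have "g a = 1" unfolding g_def by (simp add: fa)
    with g_add g_scale g_le that show thesis by blast
  qed
qed

section \<open>Topologies induced by seminorms\<close>

lemma seminorm_zero:
  assumes s: "normed_scaling s" and p: "seminorm s p"
  shows "p 0 = 0"
proof -
  have "p (s 0 0) = 0"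
    using p unfolding seminorm_def by simp
  moreover have "s 0 0 = 0"
    using normed_scaling_simps(6)[OF s, of 0 0] by simp
  ultimately show ?thesis by simp
qed

lemma seminorm_scaleR:
  fixes s :: "'k::real_or_complex \<Rightarrow> 'a::real_normed_vector \<Rightarrow> 'a"
  assumes s: "normed_scaling s" and p: "seminorm s p"
  shows "p (r *\<^sub>R x) = \<bar>r\<bar> * p x"
proof -
  have "p (s (of_real r) x) = norm (of_real r :: 'k) * p x"
    using p unfolding seminorm_def by blast
  then show ?thesis
    by (simp add: normed_scaling_simps(5)[OF s])
qed

lemma seminorm_minus_commute:
  assumes s: "normed_scaling s" and p: "seminorm s p"
  shows "p (x - y) = p (y - x)"
  using seminorm_scaleR[OF s p, of "- 1" "x - y"] by simp

lemma seminorm_nonneg: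
  assumes s: "normed_scaling s" and p: "seminorm s p"
  shows "p x \<ge> 0"
proof -
  have "p (x + - x) \<le> p x + p (- x)"
    using p unfolding seminorm_def by blast
  then show ?thesis
    using seminorm_zero[OF s p] seminorm_scaleR[OF s p, of "- 1" x] by simp
qed

lemma openin_seminorm_ball:
  assumes \<gamma>: "\<gamma> \<in> \<Gamma>" and tri: "\<And>x y. p \<gamma> (x + y) \<le> p \<gamma> x + p \<gamma> y"
  shows "openin (seminorm_topology \<Gamma> p) {z. p \<gamma> (z - a) < e}"
  unfolding openin_seminorm_topology
proof
  fix y assume y: "y \<in> {z. p \<gamma> (z - a) < e}"
  have "p \<gamma> (z - a) < e" if "p \<gamma> (z - y) < e - p \<gamma> (y - a)" for z
    using tri[of "z - y" "y - a"] that by simp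
  then show "\<exists>F d. finite F \<and> F \<subseteq> \<Gamma> \<and> d > 0 \<and>
      {z. \<forall>\<gamma>\<in>F. p \<gamma> (z - y) < d} \<subseteq> {z. p \<gamma> (z - a) < e}"
    using \<gamma> y by (intro exI[of _ "{\<gamma>}"] exI[of _ "e - p \<gamma> (y - a)"]) auto
qed

lemma Hausdorff_seminorm_topology:
  assumes s: "normed_scaling s" and p: "\<And>\<gamma>. \<gamma> \<in> \<Gamma> \<Longrightarrow> seminorm s (p \<gamma>)"
    and sep: "separating \<Gamma> p"
  shows "Hausdorff_space (seminorm_topology \<Gamma> p)"
  unfolding Hausdorff_space_def
proof (intro allI impI)
  fix x y
  assume "x \<in> topspace (seminorm_topology \<Gamma> p) \<and> y \<in> topspace (seminorm_topology \<Gamma> p) \<and> x \<noteq> y"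
  then have "x - y \<noteq> 0" by simp
  with sep obtain \<gamma> where \<gamma>: "\<gamma> \<in> \<Gamma>" and "p \<gamma> (x - y) \<noteq> 0"
    unfolding separating_def by blast
  define e where "e = p \<gamma> (x - y) / 2"
  note p\<gamma> = p[OF \<gamma>]
  have e: "e > 0"
    using seminorm_nonneg[OF s p\<gamma>, of "x - y"] \<open>p \<gamma> (x - y) \<noteq> 0\<close> unfolding e_def by simp
  have tri: "p \<gamma> (u + v) \<le> p \<gamma> u + p \<gamma> v" for u v
    using p\<gamma> unfolding seminorm_def by blast
  have "disjnt {z. p \<gamma> (z - x) < e} {z. p \<gamma> (z - y) < e}"
    unfolding disjnt_iff
  proof clarify
    fix z assume "p \<gamma> (z - x) < e" "p \<gamma> (z - y) < e"
    moreover have "p \<gamma> (x - y) \<le> p \<gamma> (z - x) + p \<gamma> (z - y)"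
      using tri[of "x - z" "z - y"] seminorm_minus_commute[OF s p\<gamma>, of x z] by simp
    ultimately show False unfolding e_def by simp
  qed
  moreover have "x \<in> {z. p \<gamma> (z - x) < e}" "y \<in> {z. p \<gamma> (z - y) < e}"
    using e seminorm_zero[OF s p\<gamma>] by simp_all
  ultimately show "\<exists>U V. openin (seminorm_topology \<Gamma> p) U \<and> openin (seminorm_topology \<Gamma> p) V \<and>
      x \<in> U \<and> y \<in> V \<and> disjnt U V"
    using openin_seminorm_ball[where p=p, OF \<gamma> tri] by blast
qed

text \<open>
  Continuity into a seminorm topology can be tested one seminorm at a time, since finitely many
  neighbourhoods can be intersected. The criterion serves for the vectors and, with the family
  indexed by pairs of a point and a seminorm, for the topology of pointwise convergence on
  operators.
\<close>

lemma continuous_map_into_seminorm_topology: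
  assumes "\<And>z \<gamma> e. z \<in> topspace Z \<Longrightarrow> \<gamma> \<in> \<Gamma> \<Longrightarrow> e > 0 \<Longrightarrow>
    \<exists>N. openin Z N \<and> z \<in> N \<and> (\<forall>w\<in>N. p \<gamma> (f w - f z) < e)"
  shows "continuous_map Z (seminorm_topology \<Gamma> p) f"
  unfolding continuous_map_def
proof (intro conjI allI impI)
  show "f \<in> topspace Z \<rightarrow> topspace (seminorm_topology \<Gamma> p)" by simp
  fix U assume U: "openin (seminorm_topology \<Gamma> p) U"
  show "openin Z {z \<in> topspace Z. f z \<in> U}"
  proof (subst openin_subopen, intro ballI)
    fix z assume z: "z \<in> {z \<in> topspace Z. f z \<in> U}"
    then have "f z \<in> U" by simp
    from bspec[OF U[unfolded openin_seminorm_topology] this] obtain F e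
      where F: "finite F" "F \<subseteq> \<Gamma>" "e > 0" "{y. \<forall>\<gamma>\<in>F. p \<gamma> (y - f z) < e} \<subseteq> U"
      by (elim exE conjE)
    have "\<exists>N. openin Z N \<and> z \<in> N \<and> (\<forall>w\<in>N. p \<gamma> (f w - f z) < e)" if "\<gamma> \<in> F" for \<gamma>
      using z F(2) that by (intro assms F(3)) auto
    then have "\<forall>\<gamma>\<in>F. \<exists>N. openin Z N \<and> z \<in> N \<and> (\<forall>w\<in>N. p \<gamma> (f w - f z) < e)" by blast
    from bchoice[OF this] obtain N
      where N: "\<forall>\<gamma>\<in>F. openin Z (N \<gamma>) \<and> z \<in> N \<gamma> \<and> (\<forall>w\<in>N \<gamma>. p \<gamma> (f w - f z) < e)" ..
    have "openin Z (topspace Z \<inter> \<Inter> (N ` F))"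
      using F(1) N by (intro openin_Int_Inter) auto
    moreover have "z \<in> topspace Z \<inter> \<Inter> (N ` F)"
      using z N by auto
    moreover have "topspace Z \<inter> \<Inter> (N ` F) \<subseteq> {z \<in> topspace Z. f z \<in> U}"
    proof
      fix w assume w: "w \<in> topspace Z \<inter> \<Inter> (N ` F)"
      with N have "f w \<in> {y. \<forall>\<gamma>\<in>F. p \<gamma> (y - f z) < e}" by simp
      with F(4) w show "w \<in> {z \<in> topspace Z. f z \<in> U}" by blast
    qed
    ultimately show "\<exists>T. openin Z T \<and> z \<in> T \<and> T \<subseteq> {z \<in> topspace Z. f z \<in> U}"
      by blast
  qed
qed

lemma continuous_map_seminorm_nhd:
  assumes s: "normed_scaling s" and p: "seminorm s (p \<gamma>)" and \<gamma>: "\<gamma> \<in> \<Gamma>"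
    and f: "continuous_map Z (seminorm_topology \<Gamma> p) f" and z: "z \<in> topspace Z" and e: "e > 0"
  shows "\<exists>N. openin Z N \<and> z \<in> N \<and> (\<forall>w\<in>N. p \<gamma> (f w - f z) < e)"
proof -
  have "openin (seminorm_topology \<Gamma> p) {y. p \<gamma> (y - f z) < e}"
    by (rule openin_seminorm_ball[OF \<gamma>]) (use p in \<open>simp add: seminorm_def\<close>)
  with f have "openin Z {w \<in> topspace Z. f w \<in> {y. p \<gamma> (y - f z) < e}}"
    unfolding continuous_map_def by blast
  with z e seminorm_zero[OF s p] show ?thesis
    by (intro exI[of _ "{w \<in> topspace Z. f w \<in> {y. p \<gamma> (y - f z) < e}}"]) auto
qed

lemma continuous_map_seminorm_add:
  assumes s: "normed_scaling s" and p: "\<And>\<gamma>. \<gamma> \<in> \<Gamma> \<Longrightarrow> seminorm s (p \<gamma>)"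
    and f: "continuous_map Z (seminorm_topology \<Gamma> p) f"
    and g: "continuous_map Z (seminorm_topology \<Gamma> p) g"
  shows "continuous_map Z (seminorm_topology \<Gamma> p) (\<lambda>z. f z + g z)"
proof (rule continuous_map_into_seminorm_topology)
  fix z \<gamma> and e :: real
  assume z: "z \<in> topspace Z" and \<gamma>: "\<gamma> \<in> \<Gamma>" and e: "e > 0"
  obtain M N where M: "openin Z M" "z \<in> M" "\<forall>w\<in>M. p \<gamma> (f w - f z) < e / 2"
    and N: "openin Z N" "z \<in> N" "\<forall>w\<in>N. p \<gamma> (g w - g z) < e / 2"
    using continuous_map_seminorm_nhd[where p=p, OF s p[OF \<gamma>] \<gamma> f z] continuous_map_seminorm_nhd[where p=p, OF s p[OF \<gamma>] \<gamma> g z] e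
    by (meson half_gt_zero)
  have "p \<gamma> (f w + g w - (f z + g z)) < e" if "w \<in> M \<inter> N" for w
  proof -
    have "p \<gamma> ((f w - f z) + (g w - g z)) \<le> p \<gamma> (f w - f z) + p \<gamma> (g w - g z)"
      using p[OF \<gamma>] unfolding seminorm_def by blast
    also have "\<dots> < e / 2 + e / 2"
      using M(3) N(3) that by (intro add_strict_mono) auto
    finally show ?thesis by (simp add: algebra_simps)
  qed
  with M N show "\<exists>N. openin Z N \<and> z \<in> N \<and> (\<forall>w\<in>N. p \<gamma> (f w + g w - (f z + g z)) < e)"
    by (intro exI[of _ "M \<inter> N"]) auto
qed

lemma continuous_map_seminorm_scale:
  assumes s: "normed_scaling s" and p: "\<And>\<gamma>. \<gamma> \<in> \<Gamma> \<Longrightarrow> seminorm s (p \<gamma>)"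
    and f: "continuous_map Z (seminorm_topology \<Gamma> p) f"
  shows "continuous_map Z (seminorm_topology \<Gamma> p) (\<lambda>z. s c (f z))"
proof (rule continuous_map_into_seminorm_topology)
  fix z \<gamma> and e :: real
  assume z: "z \<in> topspace Z" and \<gamma>: "\<gamma> \<in> \<Gamma>" and e: "e > 0"
  have c: "norm c + 1 > 0" by (simp add: add_nonneg_pos)
  \<comment> \<open>the summand one keeps the divisor positive when \<open>c = 0\<close>\<close>
  with e have "e / (norm c + 1) > 0" by simp
  then obtain N where N: "openin Z N" "z \<in> N" "\<forall>w\<in>N. p \<gamma> (f w - f z) < e / (norm c + 1)"
    using continuous_map_seminorm_nhd[where p=p, OF s p[OF \<gamma>] \<gamma> f z] by blast
  have "p \<gamma> (s c (f w) - s c (f z)) < e" if "w \<in> N" for w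
  proof -
    have "s c (f w) - s c (f z) = s c (f w - f z)"
      using normed_scaling_simps(1)[OF s, of c "f w - f z" "f z"] by simp
    then have "p \<gamma> (s c (f w) - s c (f z)) = norm c * p \<gamma> (f w - f z)"
      using p[OF \<gamma>] unfolding seminorm_def by simp
    also have "\<dots> \<le> (norm c + 1) * p \<gamma> (f w - f z)"
      using seminorm_nonneg[OF s p[OF \<gamma>]] by (intro mult_right_mono) auto
    also have "\<dots> < e"
      using N(3) that c by (simp add: field_simps)
    finally show ?thesis .
  qed
  with N show "\<exists>N. openin Z N \<and> z \<in> N \<and> (\<forall>w\<in>N. p \<gamma> (s c (f w) - s c (f z)) < e)"
    by blast
qed

text \<open>
  A ball of positive radius is a continuous image of the unit ball under scaling. The radius
  zero has to be allowed because the zero vector contributes such a factor to the product of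
  balls below.
\<close>

lemma compactin_cball_seminorm_topology:
  fixes s :: "'k::real_or_complex \<Rightarrow> 'b::real_normed_vector \<Rightarrow> 'b"
  assumes s: "normed_scaling s" and p: "\<And>\<gamma>. \<gamma> \<in> \<Gamma> \<Longrightarrow> seminorm s (p \<gamma>)"
    and cpt: "compactin (seminorm_topology \<Gamma> p) (cball 0 1)" and r: "r \<ge> 0"
  shows "compactin (seminorm_topology \<Gamma> p) (cball 0 r)"
proof (cases "r = 0")
  case False
  have "continuous_map (seminorm_topology \<Gamma> p) (seminorm_topology \<Gamma> p) (\<lambda>y. s (of_real r) y)"
    by (rule continuous_map_seminorm_scale[OF s p continuous_map_id[unfolded id_def]])
  then have "compactin (seminorm_topology \<Gamma> p) ((*\<^sub>R) r ` cball 0 1)"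
    using image_compactin[OF cpt] normed_scaling_simps(5)[OF s, of r] by simp
  moreover have "(*\<^sub>R) r ` cball 0 1 = (cball 0 r :: 'b set)"
    using cball_scale[OF False, of 0 1] r by simp
  ultimately show ?thesis by argo
qed simp

section \<open>Compactness passes from the vectors to the operators\<close>

lemma normed_scaling_vector_space: "normed_scaling s \<Longrightarrow> vector_space s"
  unfolding normed_scaling_def by blast

lemma bounded_linear_of_linear:
  assumes sX: "normed_scaling sX" and sY: "normed_scaling sY"
    and f: "Vector_Spaces.linear sX sY f" and bound: "\<And>x. norm (f x) \<le> K * norm x"
  shows "bounded_linear f"
proof (rule bounded_linear_intro)
  show "f (x + y) = f x + f y" for x y
    using f unfolding Vector_Spaces.linear_iff by blast
  show "f (r *\<^sub>R x) = r *\<^sub>R f x" for r x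
    using f normed_scaling_simps(5)[OF sX, of r x] normed_scaling_simps(5)[OF sY, of r "f x"]
    unfolding Vector_Spaces.linear_iff by metis
  show "norm (f x) \<le> norm x * K" for x
    using bound[of x] by (simp add: mult.commute)
qed

text \<open>
  In a Hausdorff topology in which the vector operations are continuous, each single instance of
  the linearity equations defines a closed set of functions, as the coincidence set of two
  continuous maps built from coordinate projections.
\<close>

lemma closedin_linear_maps:
  assumes sX: "normed_scaling sX" and sY: "normed_scaling sY"
    and p: "\<And>\<gamma>. \<gamma> \<in> \<Gamma> \<Longrightarrow> seminorm sY (p \<gamma>)" and sep: "separating \<Gamma> p"
  shows "closedin (product_topology (\<lambda>_. seminorm_topology \<Gamma> p) UNIV) {f. Vector_Spaces.linear sX sY f}"
    (is "closedin ?P _")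
proof -
  note H = Hausdorff_seminorm_topology[OF sY p sep]
  have proj: "continuous_map ?P (seminorm_topology \<Gamma> p) (\<lambda>f. f x)" for x
    by (rule continuous_map_product_projection) simp
  have add: "closedin ?P {f. f (x + y) = f x + f y}" for x y
    using closedin_continuous_maps_eq[OF H proj continuous_map_seminorm_add[OF sY p proj proj],
        of "x + y" x y] by simp
  have scale: "closedin ?P {f. f (sX c x) = sY c (f x)}" for c x
    using closedin_continuous_maps_eq[OF H proj continuous_map_seminorm_scale[OF sY p proj],
        of "sX c x" c x] by simp
  have "{f. Vector_Spaces.linear sX sY f} =
      (\<Inter>x. \<Inter>y. {f. f (x + y) = f x + f y}) \<inter> (\<Inter>c. \<Inter>x. {f. f (sX c x) = sY c (f x)})"
    using normed_scaling_vector_space[OF sX] normed_scaling_vector_space[OF sY]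
    unfolding Vector_Spaces.linear_iff by blast
  also have "closedin ?P \<dots>"
    by (intro closedin_Int closedin_INT add scale) auto
  finally show ?thesis .
qed

text \<open>
  The unit ball of operators is, as a set of functions, the set \<open>L\<close> of linear maps that send each
  \<open>x\<close> into the ball of radius \<open>norm x\<close>. By Tychonoff's theorem the product of these balls is
  compact, and \<open>L\<close> is closed in it. The map \<open>Blinfun\<close> carries \<open>L\<close> onto the unit ball and is
  continuous on \<open>L\<close>, since the product topology and the topology on operators both describe
  pointwise convergence.
\<close>

lemma compactin_unit_ball_imp_compactin_unit_ball_ops:
  fixes sX :: "'k::real_or_complex \<Rightarrow> 'a::real_normed_vector \<Rightarrow> 'a"
    and sY :: "'k \<Rightarrow> 'b::real_normed_vector \<Rightarrow> 'b"
    and p :: "'i \<Rightarrow> 'b \<Rightarrow> real"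
  assumes sX: "normed_scaling sX" and sY: "normed_scaling sY"
    and p: "\<And>\<gamma>. \<gamma> \<in> \<Gamma> \<Longrightarrow> seminorm sY (p \<gamma>)" and sep: "separating \<Gamma> p"
    and cpt: "compactin (seminorm_topology \<Gamma> p) (cball 0 1)"
  shows "compactin (tau_o sX sY \<Gamma> p) {T \<in> bounded_ops sX sY. norm T \<le> 1}"
proof -
  define P where "P = product_topology (\<lambda>_::'a. seminorm_topology \<Gamma> p) UNIV"
  define L where "L = {f. Vector_Spaces.linear sX sY f} \<inter> (\<Pi>\<^sub>E x\<in>UNIV. cball 0 (norm x))"
  define Q where "Q = seminorm_topology ((UNIV :: 'a set) \<times> \<Gamma>) (\<lambda>(x, \<gamma>) (T :: 'a \<Rightarrow>\<^sub>L 'b). p \<gamma> (blinfun_apply T x))"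
  have "compactin P (\<Pi>\<^sub>E x\<in>UNIV. cball 0 (norm x))"
    unfolding P_def compactin_PiE
    using compactin_cball_seminorm_topology[OF sY p cpt] by simp
  then have "compactin P L"
    using closedin_linear_maps[OF sX sY p sep] unfolding L_def P_def
    by (intro closed_Int_compactin)
  then have L: "compactin (subtopology P L) L"
    by (simp add: compactin_subtopology)
  have L_le: "norm (f x) \<le> 1 * norm x" if "f \<in> L" for f x
    using that unfolding L_def by (auto simp: PiE_iff)
  have Blinfun_app: "blinfun_apply (Blinfun f) = f" if "f \<in> L" for f
    using that L_le[OF that] unfolding L_def
    by (intro bounded_linear_Blinfun_apply bounded_linear_of_linear[OF sX sY, where K = 1]) auto
  have "continuous_map (subtopology P L) Q Blinfun"
    unfolding Q_def
  proof (rule continuous_map_into_seminorm_topology)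
    fix f :: "'a \<Rightarrow> 'b" and x\<gamma> :: "'a \<times> 'i" and e :: real
    assume f: "f \<in> topspace (subtopology P L)" and "x\<gamma> \<in> UNIV \<times> \<Gamma>" and e: "e > 0"
    then obtain x \<gamma> where \<gamma>: "x\<gamma> = (x, \<gamma>)" "\<gamma> \<in> \<Gamma>" by blast
    have fL: "f \<in> L" and fP: "f \<in> topspace P" using f by auto
    have "continuous_map P (seminorm_topology \<Gamma> p) (\<lambda>f. f x)"
      unfolding P_def by (rule continuous_map_product_projection) simp
    from continuous_map_seminorm_nhd[where p=p, OF sY p[OF \<gamma>(2)] \<gamma>(2) this fP e]
    obtain N where N: "openin P N" "f \<in> N" "\<forall>g\<in>N. p \<gamma> (g x - f x) < e" by blast
    have "openin (subtopology P L) (N \<inter> L)"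
      using N(1) by (auto simp: openin_subtopology)
    moreover have "\<forall>g\<in>N \<inter> L. p \<gamma> (blinfun_apply (Blinfun g - Blinfun f) x) < e"
      using N(3) fL by (simp add: blinfun.diff_left Blinfun_app)
    ultimately show "\<exists>N. openin (subtopology P L) N \<and> f \<in> N \<and>
        (\<forall>g\<in>N. (case x\<gamma> of (x, \<gamma>) \<Rightarrow> \<lambda>T. p \<gamma> (blinfun_apply T x)) (Blinfun g - Blinfun f) < e)"
      using N(2) fL \<gamma>(1) by (intro exI[of _ "N \<inter> L"]) simp
  qed
  from image_compactin[OF L this] have "compactin Q (Blinfun ` L)" .
  moreover have "Blinfun ` L = {T \<in> bounded_ops sX sY. norm T \<le> 1}"
  proof (intro equalityI subsetI)
    fix T assume "T \<in> Blinfun ` L"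
    then obtain f where f: "f \<in> L" "T = Blinfun f" by blast
    have "norm T \<le> 1"
      by (rule norm_blinfun_bound) (use L_le[OF f(1)] Blinfun_app[OF f(1)] f(2) in auto)
    then show "T \<in> {T \<in> bounded_ops sX sY. norm T \<le> 1}"
      using f Blinfun_app[OF f(1)] unfolding bounded_ops_def L_def by simp
  next
    fix T assume T: "T \<in> {T \<in> bounded_ops sX sY. norm T \<le> 1}"
    have "norm (blinfun_apply T x) \<le> norm x" for x
      using norm_blinfun[of T x] T mult_right_mono[of "norm T" 1 "norm x"] by simp
    then have "blinfun_apply T \<in> L"
      using T unfolding L_def bounded_ops_def by (auto simp: PiE_iff)
    then show "T \<in> Blinfun ` L"
      by (metis blinfun_apply_inverse image_eqI)
  qed
  ultimately show ?thesis
    unfolding tau_o_def Q_def by (auto simp: compactin_subtopology)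
qed

section \<open>Compactness passes from the operators to the vectors\<close>

text \<open>
  The operator is \<open>x \<mapsto> g x y\<close>, where \<open>g\<close> is a functional of norm one with value one at \<open>a\<close>.
\<close>

lemma rank_one_operator:
  assumes sX: "normed_scaling sX" and sY: "normed_scaling sY" and a: "norm a = 1"
  obtains T where "T \<in> bounded_ops sX sY" "norm T \<le> norm y" "blinfun_apply T a = y"
proof -
  obtain g where g: "\<And>x y. g (x + y) = g x + g y" "\<And>c x. g (sX c x) = c * g x"
    "\<And>x. norm (g x) \<le> norm x" "g a = 1"
    by (rule norming_functional[OF sX a]) blast
  have lin: "Vector_Spaces.linear sX sY (\<lambda>x. sY (g x) y)"
    unfolding Vector_Spaces.linear_iff
    using normed_scaling_vector_space[OF sX] normed_scaling_vector_space[OF sY]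
    by (simp add: g normed_scaling_simps[OF sY])
  have bound: "norm (sY (g x) y) \<le> norm y * norm x" for x
    using mult_left_mono[OF g(3), of "norm y" x] by (simp add: normed_scaling_simps[OF sY] mult.commute)
  have ap: "blinfun_apply (Blinfun (\<lambda>x. sY (g x) y)) = (\<lambda>x. sY (g x) y)"
    by (intro bounded_linear_Blinfun_apply bounded_linear_of_linear[OF sX sY lin bound])
  show thesis
  proof
    show "Blinfun (\<lambda>x. sY (g x) y) \<in> bounded_ops sX sY"
      unfolding bounded_ops_def using lin by (simp add: ap)
    show "norm (Blinfun (\<lambda>x. sY (g x) y)) \<le> norm y"
      by (rule norm_blinfun_bound) (simp_all add: ap bound)
    show "blinfun_apply (Blinfun (\<lambda>x. sY (g x) y)) a = y"
      by (simp add: ap g(4) normed_scaling_simps(4)[OF sY])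
  qed
qed

lemma continuous_map_tau_o_eval:
  assumes p: "\<And>\<gamma> x y. \<gamma> \<in> \<Gamma> \<Longrightarrow> p \<gamma> (x + y) \<le> p \<gamma> x + p \<gamma> y"
    and zero: "\<And>\<gamma>. \<gamma> \<in> \<Gamma> \<Longrightarrow> p \<gamma> 0 = 0"
  shows "continuous_map (tau_o sX sY \<Gamma> p) (seminorm_topology \<Gamma> p) (\<lambda>T. blinfun_apply T a)"
  unfolding tau_o_def
proof (intro continuous_map_from_subtopology continuous_map_into_seminorm_topology)
  fix T \<gamma> and e :: real
  assume \<gamma>: "\<gamma> \<in> \<Gamma>" and e: "e > 0"
  let ?q = "\<lambda>(x, \<gamma>) T. p \<gamma> (blinfun_apply T x)"
  have "openin (seminorm_topology (UNIV \<times> \<Gamma>) ?q) {S. ?q (a, \<gamma>) (S - T) < e}"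
    by (rule openin_seminorm_ball) (use \<gamma> p in \<open>auto simp: blinfun.add_left\<close>)
  then show "\<exists>N. openin (seminorm_topology (UNIV \<times> \<Gamma>) ?q) N \<and> T \<in> N \<and>
      (\<forall>S\<in>N. p \<gamma> (blinfun_apply S a - blinfun_apply T a) < e)"
    by (intro exI[of _ "{S. ?q (a, \<gamma>) (S - T) < e}"]) (use e zero[OF \<gamma>] in \<open>simp add: blinfun.diff_left\<close>)
qed

text \<open>
  Evaluation at a unit vector is continuous and maps the unit ball of operators into the unit ball
  of the target space; the rank-one operators show that it is onto.
\<close>

lemma compactin_unit_ball_ops_imp_compactin_unit_ball:
  fixes sX :: "'k::real_or_complex \<Rightarrow> 'a::real_normed_vector \<Rightarrow> 'a"
    and sY :: "'k \<Rightarrow> 'b::real_normed_vector \<Rightarrow> 'b"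
    and p :: "'i \<Rightarrow> 'b \<Rightarrow> real"
  assumes sX: "normed_scaling sX" and nz: "\<exists>x::'a. x \<noteq> 0" and sY: "normed_scaling sY"
    and p: "\<And>\<gamma>. \<gamma> \<in> \<Gamma> \<Longrightarrow> seminorm sY (p \<gamma>)"
    and cpt: "compactin (tau_o sX sY \<Gamma> p) {T \<in> bounded_ops sX sY. norm T \<le> 1}"
  shows "compactin (seminorm_topology \<Gamma> p) (cball 0 1)"
proof -
  obtain x :: 'a where "x \<noteq> 0" using nz by blast
  define a where "a = sgn x"
  have a: "norm a = 1" using \<open>x \<noteq> 0\<close> by (simp add: a_def norm_sgn)
  have "continuous_map (tau_o sX sY \<Gamma> p) (seminorm_topology \<Gamma> p) (\<lambda>T. blinfun_apply T a)"
    by (rule continuous_map_tau_o_eval) (use p seminorm_zero[OF sY p] in \<open>auto simp: seminorm_def\<close>)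
  then have "compactin (seminorm_topology \<Gamma> p)
      ((\<lambda>T. blinfun_apply T a) ` {T \<in> bounded_ops sX sY. norm T \<le> 1})"
    by (rule image_compactin[OF cpt])
  moreover have "(\<lambda>T. blinfun_apply T a) ` {T \<in> bounded_ops sX sY. norm T \<le> 1} = cball 0 1"
  proof (intro equalityI subsetI)
    fix y assume "y \<in> (\<lambda>T. blinfun_apply T a) ` {T \<in> bounded_ops sX sY. norm T \<le> 1}"
    then obtain T where "norm T \<le> 1" "y = blinfun_apply T a" by blast
    then show "y \<in> cball 0 1" using norm_blinfun[of T a] a by simp
  next
    fix y :: 'b assume "y \<in> cball 0 1"
    moreover obtain T where "T \<in> bounded_ops sX sY" "norm T \<le> norm y" "blinfun_apply T a = y"
      by (rule rank_one_operator[OF sX sY a])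
    ultimately show "y \<in> (\<lambda>T. blinfun_apply T a) ` {T \<in> bounded_ops sX sY. norm T \<le> 1}"
      by (intro image_eqI[of _ _ T]) auto
  qed
  ultimately show ?thesis by simp
qed

section \<open>The equivalence\<close>

theorem theorem3p1:
  fixes sX :: "'k::real_or_complex \<Rightarrow> 'a::banach \<Rightarrow> 'a"
    and sY :: "'k \<Rightarrow> 'b::banach \<Rightarrow> 'b"
    and \<tau> :: "'b topology"
    and \<Gamma> :: "'i set"
    and p :: "'i \<Rightarrow> 'b \<Rightarrow> real"
  assumes X: "normed_scaling sX"
    and X_nonzero: "\<exists>x::'a. x \<noteq> 0"
    and Y: "normed_scaling sY"
    and seminorms: "\<And>\<gamma>. \<gamma> \<in> \<Gamma> \<Longrightarrow> seminorm sY (p \<gamma>)"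
    and separating: "separating \<Gamma> p"
    and induced: "\<tau> = seminorm_topology \<Gamma> p"
    and weaker: "\<And>U. openin \<tau> U \<Longrightarrow> open U"
    and norming: "\<And>y. ennreal (norm y) \<le>
      (SUP \<gamma>\<in>{\<gamma>\<in>\<Gamma>. seminorm_norm (p \<gamma>) \<le> 1}. ennreal \<bar>p \<gamma> y\<bar>)"
  shows "compactin \<tau> (cball 0 1) \<longleftrightarrow>
    compactin (tau_o sX sY \<Gamma> p) {T \<in> bounded_ops sX sY. norm T \<le> 1}"
  unfolding induced
proof (rule iffI)
  assume "compactin (seminorm_topology \<Gamma> p) (cball 0 1)"
  then show "compactin (tau_o sX sY \<Gamma> p) {T \<in> bounded_ops sX sY. norm T \<le> 1}"
    by (intro compactin_unit_ball_imp_compactin_unit_ball_ops X Y seminorms separating)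
next
  assume "compactin (tau_o sX sY \<Gamma> p) {T \<in> bounded_ops sX sY. norm T \<le> 1}"
  then show "compactin (seminorm_topology \<Gamma> p) (cball 0 1)"
    by (intro compactin_unit_ball_ops_imp_compactin_unit_ball[OF X X_nonzero Y] seminorms)
qed

end
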